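(* Consider the two-player pile game with boundary with set of choices $R=\{1,-1\}$ (probability $p$ of $+1$ and $q=1-p$ of $-1$) and target $n\ge1$. Then for every $n$ the winning probability generating functions $W_{n,s_1,s_2}(x)$ of the first player, for all $0\le s_1,s_2\le n$, are rational functions which can all be written with the same denominator, a polynomial of degree at most $n(n+1)$ (with nonzero constant term). Equivalently, the sequence $k\mapsto w_n(k,s_1,s_2)$ is C-finite of order at most $n(n+1)$, and the recurrence relation is the same for all values of $s_1$ and $s_2$ (with different initial values).
   Context: Two-player pile game with boundary, $R=\{1,-1\}$: the first and second player start with $s_1$ and $s_2$ chips, and move alternately, the first player moving first. At his turn a player, independently of everything else, adds one chip to his pile with probability $p$ and removes one chip with probability $q=1-p$, except that if his pile has $0$ chips it stays at $0$ instead of decreasing. The player who first has $n$ chips wins and the game ends. $w_n(k,s_1,s_2)$ is the probability that the first player wins at his own $k$-th turn, and $W_{n,s_1,s_2}(x)=\sum_{k\ge0}w_n(k,s_1,s_2)x^k$. Boundary conventions: $W_{n,n,s_2}(x)=1$ for $0\le s_2\le n$ and $W_{n,s_1,n}(x)=0$ for $0\le s_1<n$. A sequence $a(k)$ is C-finite of order at most $L$ if there are constants $c_1,\dots,c_L$ with $a(k)+c_1a(k-1)+\dots+c_La(k-L)=0$ for all sufficiently large $k$; equivalently, its generating function is a rational function with denominator $1+c_1x+\dots+c_Lx^L$. *)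

theory Defs
  imports "HOL-Probability.Probability" "HOL-Computational_Algebra.Computational_Algebra"
begin

(* Truncated subtraction on nat is the boundary rule: an empty pile stays empty. *)
definition move_chip :: "bool \<Rightarrow> nat \<Rightarrow> nat" where
  "move_chip gain s = (if gain then s + 1 else s - 1)"

definition game_over :: "nat \<Rightarrow> nat \<times> nat \<Rightarrow> bool" where
  "game_over n = (\<lambda>(a, b). a = n \<or> b = n)"

(* The two piles after t individual moves, frozen once the game is over. Move t (counted from 0)
   uses the t-th entry of the stream (True: add a chip) and belongs to the first player iff t is
   even, so his k-th turn is move 2 * k - 2. *)
primrec piles :: "nat \<Rightarrow> nat \<Rightarrow> nat \<Rightarrow> bool stream \<Rightarrow> nat \<Rightarrow> nat \<times> nat" where
  "piles n s1 s2 \<omega> 0 = (s1, s2)"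
| "piles n s1 s2 \<omega> (Suc t) =
     (if game_over n (piles n s1 s2 \<omega> t) then piles n s1 s2 \<omega> t
      else if even t
        then (move_chip (\<omega> !! t) (fst (piles n s1 s2 \<omega> t)), snd (piles n s1 s2 \<omega> t))
        else (fst (piles n s1 s2 \<omega> t), move_chip (\<omega> !! t) (snd (piles n s1 s2 \<omega> t))))"

(* A first player who already has n chips at the start has won "at turn 0". *)
fun first_wins_at :: "nat \<Rightarrow> nat \<Rightarrow> nat \<Rightarrow> nat \<Rightarrow> bool stream \<Rightarrow> bool" where
  "first_wins_at n s1 s2 0 \<omega> \<longleftrightarrow> s1 = n"
| "first_wins_at n s1 s2 (Suc k) \<omega> \<longleftrightarrow>
     \<not> game_over n (piles n s1 s2 \<omega> (2 * k)) \<and> fst (piles n s1 s2 \<omega> (2 * k + 1)) = n"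

definition coins :: "real \<Rightarrow> bool stream measure" where
  "coins p = stream_space (measure_pmf (bernoulli_pmf p))"

definition win_prob :: "nat \<Rightarrow> real \<Rightarrow> nat \<Rightarrow> nat \<Rightarrow> nat \<Rightarrow> real" where
  "win_prob n p s1 s2 k = measure (coins p) {\<omega> \<in> space (coins p). first_wins_at n s1 s2 k \<omega>}"

definition win_gf :: "nat \<Rightarrow> real \<Rightarrow> nat \<Rightarrow> nat \<Rightarrow> real fps" where
  "win_gf n p s1 s2 = Abs_fps (win_prob n p s1 s2)"

(* Only c 1, ..., c L matter. *)
definition C_finite_with :: "nat \<Rightarrow> (nat \<Rightarrow> real) \<Rightarrow> (nat \<Rightarrow> real) \<Rightarrow> bool" where
  "C_finite_with L c a \<longleftrightarrow>
     (\<forall>\<^sub>F k in sequentially. a k + (\<Sum>j = 1..L. c j * a (k - j)) = 0)"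

lemma prob_space_coins: "prob_space (coins p)"
  unfolding coins_def by (rule prob_space.prob_space_stream_space) (rule prob_space_measure_pmf)

lemma measurable_piles:
  "(\<lambda>\<omega>. piles n s1 s2 \<omega> t) \<in> coins p \<rightarrow>\<^sub>M count_space UNIV"
proof (induction t)
  case 0
  show ?case by simp
next
  case (Suc t)
  have nth: "(\<lambda>\<omega>. \<omega> !! t) \<in> coins p \<rightarrow>\<^sub>M count_space UNIV"
    unfolding coins_def
    by (rule measurable_compose[OF measurable_snth[of t "measure_pmf (bernoulli_pmf p)"]]) simp
  have "(\<lambda>\<omega>. (piles n s1 s2 \<omega> t, \<omega> !! t)) \<in> coins p \<rightarrow>\<^sub>M count_space UNIV \<Otimes>\<^sub>M count_space UNIV"
    using Suc nth by simp
  then have "(\<lambda>\<omega>. (piles n s1 s2 \<omega> t, \<omega> !! t)) \<in> coins p \<rightarrow>\<^sub>M count_space UNIV"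
    by (simp add: pair_measure_countable)
  then have "(\<lambda>\<omega>. (\<lambda>(x, b). if game_over n x then x
        else if even t then (move_chip b (fst x), snd x) else (fst x, move_chip b (snd x)))
      (piles n s1 s2 \<omega> t, \<omega> !! t)) \<in> coins p \<rightarrow>\<^sub>M count_space UNIV"
    by (rule measurable_compose) simp
  then show ?case by simp
qed

lemma first_wins_at_event:
  "{\<omega> \<in> space (coins p). first_wins_at n s1 s2 k \<omega>} \<in> sets (coins p)"
proof (cases k)
  case 0
  then show ?thesis by (cases "s1 = n") auto
next
  case (Suc m)
  note [measurable] = measurable_piles[of n s1 s2]
  show ?thesis unfolding Suc first_wins_at.simps by measurable
qed

lemma win_gf_first_at_target: "win_gf n p n s2 = 1"
proof -
  have "win_prob n p n s2 k = (if k = 0 then 1 else 0)" for k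
  proof (cases k)
    case 0
    then show ?thesis by (simp add: win_prob_def prob_space.prob_space prob_space_coins)
  next
    case (Suc m)
    have "game_over n (piles n n s2 \<omega> t)" for \<omega> t
      by (induction t) (simp_all add: game_over_def)
    with Suc show ?thesis by (simp add: win_prob_def)
  qed
  then show ?thesis by (simp add: win_gf_def fps_eq_iff)
qed

lemma win_gf_second_at_target:
  assumes "s1 < n"
  shows "win_gf n p s1 n = 0"
proof -
  have "win_prob n p s1 n k = 0" for k
  proof (cases k)
    case 0
    with assms show ?thesis by (simp add: win_prob_def)
  next
    case (Suc m)
    have "game_over n (piles n s1 n \<omega> t)" for \<omega> t
      by (induction t) (simp_all add: game_over_def)
    with Suc show ?thesis by (simp add: win_prob_def)
  qed
  then show ?thesis by (simp add: win_gf_def fps_eq_iff)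
qed

end

theory Submission
  imports Defs
begin

text \<open>
  While neither pile has n chips, one round (a turn of each player) leads from \<open>(s1, s2)\<close> to a
  random pair of piles, and the probability of winning one turn later is the average over that pair.
  So, from turn 1 on, the probabilities for the \<open>n * n\<close> non-terminal pairs form a vector
  evolving under a fixed linear map. Among its first \<open>n * n + 1\<close> values there is a linear
  dependence, and applying the map to it repeatedly yields one recurrence, of order at most
  \<open>n * n\<close>, valid for all pairs at once.
\<close>

section \<open>Linear dependence by elimination\<close>

text \<open>Gaussian elimination by induction on the equations \<open>S\<close>, with
  \<open>I\<close> indexing the unknowns. If some \<open>u j s\<close> is nonzero, equation
  \<open>s\<close> eliminates unknown \<open>j\<close> from the others; otherwise equation
  \<open>s\<close> holds for every \<open>c\<close>.\<close>

lemma homogeneous_system_nontrivial_solution: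
  fixes u :: "'i \<Rightarrow> 's \<Rightarrow> 'a :: field"
  assumes "finite S" "finite I" "card S < card I"
  shows "\<exists>c. (\<exists>i\<in>I. c i \<noteq> 0) \<and> (\<forall>s\<in>S. (\<Sum>i\<in>I. c i * u i s) = 0)"
  using assms
proof (induction S arbitrary: I u rule: finite_induct)
  case empty
  then have "I \<noteq> {}" by auto
  then show ?case by (intro exI[of _ "\<lambda>_. 1"]) auto
next
  case (insert s S)
  show ?case
  proof (cases "\<forall>i\<in>I. u i s = 0")
    case True
    have "card S < card I" using insert.prems insert.hyps by simp
    from insert.IH[OF insert.prems(1) this, of u]
    obtain c where "\<exists>i\<in>I. c i \<noteq> 0" "\<forall>t\<in>S. (\<Sum>i\<in>I. c i * u i t) = 0"
      by blast
    moreover have "(\<Sum>i\<in>I. c i * u i s) = 0"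
      using True by (intro sum.neutral) simp
    ultimately show ?thesis by auto
  next
    case False
    then obtain j where j: "j \<in> I" "u j s \<noteq> 0" by blast
    define J where "J = I - {j}"
    have I: "I = insert j J" "j \<notin> J" "finite J"
      using j insert.prems by (auto simp: J_def)
    have "card S < card J"
      using insert.prems insert.hyps I by simp
    from insert.IH[OF I(3) this, of "\<lambda>i t. u i t - u i s / u j s * u j t"]
    obtain c where c: "\<exists>i\<in>J. c i \<noteq> 0"
      "\<And>t. t \<in> S \<Longrightarrow> (\<Sum>i\<in>J. c i * (u i t - u i s / u j s * u j t)) = 0"
      by blast
    \<comment> \<open>Back-substitution: the value at \<open>j\<close> is the one that solves
      equation \<open>s\<close>.\<close>
    define d where "d = (\<lambda>i. if i = j then - (\<Sum>i\<in>J. c i * u i s) / u j s else c i)"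
    have d: "(\<Sum>i\<in>I. d i * u i t) = - (\<Sum>i\<in>J. c i * u i s) / u j s * u j t + (\<Sum>i\<in>J. c i * u i t)"
      for t
    proof -
      have "(\<Sum>i\<in>J. d i * u i t) = (\<Sum>i\<in>J. c i * u i t)"
        using I by (intro sum.cong) (auto simp: d_def)
      then show ?thesis using I by (simp add: d_def)
    qed
    have "(\<Sum>i\<in>I. d i * u i t) = 0" if "t \<in> S" for t
    proof -
      have "(\<Sum>i\<in>J. c i * (u i t - u i s / u j s * u j t)) =
          (\<Sum>i\<in>J. c i * u i t) - (\<Sum>i\<in>J. c i * u i s) / u j s * u j t"
        by (simp add: right_diff_distrib sum_subtractf sum_distrib_right sum_divide_distrib mult.assoc)
      with c(2)[OF that] show ?thesis by (simp add: d)
    qed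
    moreover have "(\<Sum>i\<in>I. d i * u i s) = 0"
      using j by (simp add: d)
    moreover have "\<exists>i\<in>I. d i \<noteq> 0"
      using c(1) I by (auto simp: d_def)
    ultimately show ?thesis by auto
  qed
qed

text \<open>A dependence among the first \<open>card S + 1\<close> vectors is divided by its last
  nonzero coefficient. Counting indices down from \<open>d\<close> gives it the shape of a
  recurrence.\<close>

lemma linear_dependence_normalised:
  fixes u :: "nat \<Rightarrow> 's \<Rightarrow> 'a :: field"
  assumes "finite S"
  shows "\<exists>d c. d \<le> card S \<and> (\<forall>s\<in>S. u d s + (\<Sum>j = 1..d. c j * u (d - j) s) = 0)"
proof -
  obtain b where b: "\<exists>i\<in>{..card S}. b i \<noteq> 0"
    "\<And>s. s \<in> S \<Longrightarrow> (\<Sum>i\<le>card S. b i * u i s) = 0"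
    using homogeneous_system_nontrivial_solution[OF assms, of "{..card S}" u] by auto
  \<comment> \<open>With the largest such index, division by \<open>b d\<close> is possible and all
    terms beyond \<open>d\<close> vanish.\<close>
  define d where "d = Max {i. i \<le> card S \<and> b i \<noteq> 0}"
  have fin: "finite {i. i \<le> card S \<and> b i \<noteq> 0}" by simp
  have "d \<in> {i. i \<le> card S \<and> b i \<noteq> 0}"
    unfolding d_def using b(1) by (intro Max_in[OF fin]) auto
  then have d: "d \<le> card S" "b d \<noteq> 0" by auto
  have above: "b i = 0" if "i \<le> card S" "d < i" for i
  proof (rule ccontr)
    assume "b i \<noteq> 0"
    with that(1) have "i \<le> d" unfolding d_def by (intro Max_ge[OF fin]) simp
    with that(2) show False by simp
  qed
  have "u d s + (\<Sum>j = 1..d. b (d - j) / b d * u (d - j) s) = 0" if "s \<in> S" for s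
  proof -
    have "0 = (\<Sum>i\<le>d. b i * u i s)"
      unfolding b(2)[OF that, symmetric]
      by (rule sum.mono_neutral_right) (use d above in auto)
    also have "\<dots> = (\<Sum>j\<le>d. b (d - j) * u (d - j) s)"
      using sum.nat_diff_reindex[of "\<lambda>i. b i * u i s" "Suc d"] by (simp add: lessThan_Suc_atMost)
    also have "\<dots> = b d * u d s + (\<Sum>j = 1..d. b (d - j) * u (d - j) s)"
      by (simp add: atMost_atLeast0 sum.atLeast_Suc_atMost)
    finally have "(\<Sum>j = 1..d. b (d - j) * u (d - j) s) = - (b d * u d s)"
      by (simp add: eq_neg_iff_add_eq_0 add.commute)
    then have "(\<Sum>j = 1..d. b (d - j) / b d * u (d - j) s) = - u d s"
      using d(2) by (simp flip: sum_divide_distrib)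
    then show ?thesis by simp
  qed
  with d(1) show ?thesis
    by (intro exI[of _ d] exI[of _ "\<lambda>j. b (d - j) / b d"] conjI ballI)
qed

section \<open>Recurrences and rational generating functions\<close>

text \<open>Multiplying the series by the denominator yields, for large \<open>k\<close>, the
  left-hand sides of the recurrence as coefficients. These vanish, so the product is a
  polynomial.\<close>

lemma C_finite_with_rational:
  assumes "C_finite_with L c a"
  shows "\<exists>N. Abs_fps a = fps_of_poly N / fps_of_poly (1 + (\<Sum>j = 1..L. monom (c j) j))"
proof -
  let ?D = "1 + (\<Sum>j = 1..L. monom (c j) j) :: real poly"
  let ?F = "Abs_fps a * fps_of_poly ?D"
  have D: "fps_of_poly ?D = 1 + (\<Sum>j = 1..L. fps_const (c j) * fps_X ^ j)"
    by (simp only: fps_of_poly_add fps_of_poly_sum fps_of_poly_monom fps_of_poly_1)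
  \<comment> \<open>For \<open>k < j\<close> the contribution is 0, whereas truncated subtraction
    would read \<open>a 0\<close>. From \<open>K + L\<close> on this case cannot occur.\<close>
  have nth: "fps_nth ?F k = a k + (\<Sum>j = 1..L. c j * (if k < j then 0 else a (k - j)))" for k
  proof -
    have "fps_nth (Abs_fps a * (fps_const (c j) * fps_X ^ j)) k =
        c j * (if k < j then 0 else a (k - j))" for j
    proof -
      have "Abs_fps a * (fps_const (c j) * fps_X ^ j) = fps_const (c j) * (fps_X ^ j * Abs_fps a)"
        by (simp add: mult_ac)
      then show ?thesis
        by (simp only: fps_mult_left_const_nth fps_X_power_mult_nth) simp
    qed
    then show ?thesis
      unfolding D by (simp add: distrib_left sum_distrib_left fps_sum_nth)
  qed
  from assms obtain K where K: "\<And>k. k \<ge> K \<Longrightarrow> a k + (\<Sum>j = 1..L. c j * a (k - j)) = 0"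
    by (auto simp: C_finite_with_def eventually_sequentially)
  have zero: "fps_nth ?F k = 0" if "k \<ge> K + L" for k
  proof -
    have "(\<Sum>j = 1..L. c j * (if k < j then 0 else a (k - j))) = (\<Sum>j = 1..L. c j * a (k - j))"
      using that by (intro sum.cong) auto
    with K[of k] that show ?thesis unfolding nth by simp
  qed
  define N where "N = (\<Sum>k<K + L. monom (fps_nth ?F k) k)"
  have "?F = fps_of_poly N"
    by (rule fps_ext) (use zero in \<open>auto simp: N_def coeff_sum simp del: fps_mult_nth\<close>)
  moreover have "fps_of_poly ?D \<noteq> 0"
    by (auto simp: fps_eq_iff coeff_sum intro!: exI[of _ 0])
  ultimately have "Abs_fps a = fps_of_poly N / fps_of_poly ?D"
    by (metis nonzero_mult_div_cancel_right)
  then show ?thesis ..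
qed

section \<open>Splitting off one round\<close>

lemma game_over_piles:
  assumes "game_over n (s1, s2)"
  shows "piles n s1 s2 \<omega> t = (s1, s2)"
  using assms by (induction t) auto

text \<open>This covers \<open>s1 = n\<close> too, since that win counts at turn 0. Hence terminal
  pairs satisfy any linear recurrence that only involves turns from 1 on.\<close>

lemma win_prob_game_over:
  assumes "game_over n (s1, s2)"
  shows "win_prob n p s1 s2 (Suc k) = 0"
  using assms by (simp add: win_prob_def game_over_piles)

text \<open>Dropping two coins keeps the parity of the move index, so the players still alternate in
  the same order. The last assumption ensures that the second player gets to move.\<close>

lemma piles_round:
  assumes "s1 < n" "s2 < n" "move_chip b1 s1 \<noteq> n"
  shows "piles n s1 s2 (b1 ## b2 ## \<omega>) (Suc (Suc t)) =
    piles n (move_chip b1 s1) (move_chip b2 s2) \<omega> t"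
proof (induction t)
  case 0
  show ?case using assms by (simp add: game_over_def)
next
  case (Suc t)
  show ?case
    unfolding piles.simps(2)[of n s1 s2 "b1 ## b2 ## \<omega>" "Suc (Suc t)"] Suc by simp
qed

text \<open>If the first move already wins, the actual game freezes at \<open>(n, s2)\<close> and
  the second coin is ignored on the left only. Both sides are then false, so the equivalence has no
  exception.\<close>

lemma first_wins_at_round:
  assumes "s1 < n" "s2 < n"
  shows "first_wins_at n s1 s2 (Suc (Suc k)) (b1 ## b2 ## \<omega>) \<longleftrightarrow>
    first_wins_at n (move_chip b1 s1) (move_chip b2 s2) (Suc k) \<omega>"
proof (cases "move_chip b1 s1 = n")
  case True
  have "piles n s1 s2 (b1 ## b2 ## \<omega>) (Suc t) = (n, s2)" for t
    using assms True by (induction t) (auto simp: game_over_def)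
  then have "game_over n (piles n s1 s2 (b1 ## b2 ## \<omega>) (2 * Suc k))"
    by (simp add: game_over_def del: piles.simps)
  moreover have "game_over n (move_chip b1 s1, move_chip b2 s2)"
    using True by (simp add: game_over_def)
  ultimately show ?thesis
    by (simp add: game_over_piles del: piles.simps)
next
  case False
  have "piles n s1 s2 (b1 ## b2 ## \<omega>) (2 * Suc k) =
      piles n (move_chip b1 s1) (move_chip b2 s2) \<omega> (2 * k)"
    using piles_round[OF assms False] by (simp del: piles.simps)
  moreover have "piles n s1 s2 (b1 ## b2 ## \<omega>) (2 * Suc k + 1) =
      piles n (move_chip b1 s1) (move_chip b2 s2) \<omega> (2 * k + 1)"
    using piles_round[OF assms False, of b2 \<omega> "Suc (2 * k)"] by (simp del: piles.simps)
  ultimately show ?thesis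
    unfolding first_wins_at.simps by metis
qed

text \<open>Conditioning on the first coin.\<close>

lemma measure_coins_Cons:
  assumes "0 \<le> p" "p \<le> 1" and "{\<omega> \<in> space (coins p). P \<omega>} \<in> sets (coins p)"
  shows "measure (coins p) {\<omega> \<in> space (coins p). P \<omega>} =
    p * measure (coins p) {\<omega> \<in> space (coins p). P (True ## \<omega>)} +
    (1 - p) * measure (coins p) {\<omega> \<in> space (coins p). P (False ## \<omega>)}"
proof -
  let ?M = "measure (coins p)"
  have "ennreal (?M {\<omega> \<in> space (coins p). P \<omega>}) =
      (\<integral>\<^sup>+b. ennreal (?M {\<omega> \<in> space (coins p). P (b ## \<omega>)}) \<partial>measure_pmf (bernoulli_pmf p))"
    using prob_space.prob_stream_space[OF prob_space_measure_pmf assms(3)[unfolded coins_def]]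
    by (simp only: coins_def)
  also have "\<dots> = ennreal (p * ?M {\<omega> \<in> space (coins p). P (True ## \<omega>)} +
      (1 - p) * ?M {\<omega> \<in> space (coins p). P (False ## \<omega>)})"
    using assms(1,2)
    by (simp add: ennreal_mult'' mult.commute)
  finally show ?thesis
    using assms(1,2) by (subst (asm) ennreal_inj) auto
qed

lemma space_coins [simp]: "space (coins p) = UNIV"
  by (simp add: coins_def space_stream_space)

text \<open>Supplies the measurability required for conditioning on a second coin.\<close>

lemma sets_coins_Cons:
  assumes "{\<omega> \<in> space (coins p). P \<omega>} \<in> sets (coins p)"
  shows "{\<omega> \<in> space (coins p). P (b ## \<omega>)} \<in> sets (coins p)"
proof -
  have "(\<lambda>\<omega>. b ## \<omega>) \<in> coins p \<rightarrow>\<^sub>M coins p"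
    unfolding coins_def by measurable
  from measurable_sets[OF this assms] show ?thesis by (simp add: vimage_def)
qed

lemma win_prob_round:
  assumes "s1 < n" "s2 < n" "0 \<le> p" "p \<le> 1"
  shows "win_prob n p s1 s2 (Suc (Suc k)) =
    (\<Sum>(b1, b2)\<in>UNIV. pmf (bernoulli_pmf p) b1 * pmf (bernoulli_pmf p) b2 *
       win_prob n p (move_chip b1 s1) (move_chip b2 s2) (Suc k))"
proof -
  let ?w = "\<lambda>b1 b2. win_prob n p (move_chip b1 s1) (move_chip b2 s2) (Suc k)"
  note ev = first_wins_at_event[of p n s1 s2 "Suc (Suc k)"]
  note ev2 = sets_coins_Cons[OF ev]
  have "win_prob n p s1 s2 (Suc (Suc k)) =
      p * (p * ?w True True + (1 - p) * ?w True False) +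
      (1 - p) * (p * ?w False True + (1 - p) * ?w False False)"
    unfolding win_prob_def measure_coins_Cons[OF assms(3,4) ev]
      measure_coins_Cons[OF assms(3,4) ev2] first_wins_at_round[OF assms(1,2)] ..
  then show ?thesis
    using assms(3,4) by (simp add: UNIV_bool flip: UNIV_Times_UNIV) (simp add: algebra_simps)
qed

section \<open>One recurrence for all pairs of piles\<close>

text \<open>The range \<open>k > d\<close> keeps every index \<open>k - j\<close> at least 1, so the
  exceptional value at turn 0 never enters.\<close>

lemma win_prob_common_recurrence:
  assumes "0 \<le> p" "p \<le> 1"
  shows "\<exists>d c. d \<le> n * n \<and> (\<forall>s1\<le>n. \<forall>s2\<le>n. \<forall>k>d.
    win_prob n p s1 s2 k + (\<Sum>j = 1..d. c j * win_prob n p s1 s2 (k - j)) = 0)"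
proof -
  let ?u = "\<lambda>i (s1, s2). win_prob n p s1 s2 (Suc i)"
  obtain d c where d: "d \<le> n * n" and
    c: "\<And>s. s \<in> {..<n} \<times> {..<n} \<Longrightarrow> ?u d s + (\<Sum>j = 1..d. c j * ?u (d - j) s) = 0"
    using linear_dependence_normalised[of "{..<n} \<times> {..<n}" ?u]
    by (auto simp: card_cartesian_product)
  let ?w = "win_prob n p"
  \<comment> \<open>The defect of the recurrence after \<open>m\<close> further turns. It is linear
    in the probabilities, so each defect at \<open>Suc m\<close> is an average of defects at
    \<open>m\<close>.\<close>
  let ?R = "\<lambda>m s1 s2. ?w s1 s2 (Suc (d + m)) + (\<Sum>j = 1..d. c j * ?w s1 s2 (Suc (d - j + m)))"
  have "?R m s1 s2 = 0" if "s1 \<le> n" "s2 \<le> n" for m s1 s2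
    using that
  proof (induction m arbitrary: s1 s2)
    case 0
    show ?case
    proof (cases "s1 < n \<and> s2 < n")
      case True
      then show ?thesis using c[of "(s1, s2)"] by simp
    next
      case False
      with 0 have "game_over n (s1, s2)" by (auto simp: game_over_def)
      then show ?thesis by (simp add: win_prob_game_over)
    qed
  next
    case (Suc m)
    show ?case
    proof (cases "s1 < n \<and> s2 < n")
      case True
      let ?q = "\<lambda>b1 b2. pmf (bernoulli_pmf p) b1 * pmf (bernoulli_pmf p) b2"
      have round: "?w s1 s2 (Suc (i + Suc m)) =
          (\<Sum>(b1, b2)\<in>UNIV. ?q b1 b2 * ?w (move_chip b1 s1) (move_chip b2 s2) (Suc (i + m)))" for i
        using win_prob_round[of s1 n s2 p "i + m"] True assms by simp
      have "(\<Sum>j = 1..d. c j * ?w s1 s2 (Suc (d - j + Suc m))) =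
          (\<Sum>(b1, b2)\<in>UNIV. ?q b1 b2 *
            (\<Sum>j = 1..d. c j * ?w (move_chip b1 s1) (move_chip b2 s2) (Suc (d - j + m))))"
        unfolding round sum_distrib_left case_prod_unfold
        by (subst sum.swap) (simp only: mult.left_commute)
      then have "?R (Suc m) s1 s2 =
          (\<Sum>(b1, b2)\<in>UNIV. ?q b1 b2 * ?R m (move_chip b1 s1) (move_chip b2 s2))"
        by (simp only: round case_prod_unfold distrib_left sum.distrib)
      also have "\<dots> = 0"
      proof (rule sum.neutral, safe)
        fix b1 b2
        \<comment> \<open>A round may end in a terminal pair but never exceeds \<open>n\<close>, so
          the induction hypothesis applies.\<close>
        have "move_chip b s \<le> n" if "s < n" for b s
          using that by (auto simp: move_chip_def)
        with True have "?R m (move_chip b1 s1) (move_chip b2 s2) = 0"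
          by (intro Suc.IH) auto
        then show "?q b1 b2 * ?R m (move_chip b1 s1) (move_chip b2 s2) = 0"
          by (simp only: mult_zero_right)
      qed
      finally show ?thesis .
    next
      case False
      with Suc.prems have "game_over n (s1, s2)" by (auto simp: game_over_def)
      then show ?thesis by (simp add: win_prob_game_over)
    qed
  qed
  note R = this
  have "?w s1 s2 k + (\<Sum>j = 1..d. c j * ?w s1 s2 (k - j)) = 0"
    if "s1 \<le> n" "s2 \<le> n" "d < k" for s1 s2 k
  proof -
    from \<open>d < k\<close> obtain m where m: "k = Suc (d + m)" using less_iff_Suc_add by auto
    have "(\<Sum>j = 1..d. c j * ?w s1 s2 (Suc (d - j + m))) = (\<Sum>j = 1..d. c j * ?w s1 s2 (k - j))"
      by (rule sum.cong) (auto simp: m Suc_diff_le)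
    with R[OF that(1,2), of m] show ?thesis by (simp add: m)
  qed
  with d show ?thesis by blast
qed

theorem theorem9:
  fixes n :: nat and p :: real
  assumes "n \<ge> 1" and "0 \<le> p" and "p \<le> 1"
  shows "(\<exists>D :: real poly. degree D \<le> n * (n + 1) \<and> coeff D 0 \<noteq> 0 \<and>
            (\<forall>s1 \<le> n. \<forall>s2 \<le> n. \<exists>N :: real poly.
               win_gf n p s1 s2 = fps_of_poly N / fps_of_poly D)) \<and>
         (\<exists>c :: nat \<Rightarrow> real. \<forall>s1 \<le> n. \<forall>s2 \<le> n.
            C_finite_with (n * (n + 1)) c (win_prob n p s1 s2))"
proof -
  let ?L = "n * (n + 1)"
  obtain d c where d: "d \<le> n * n" and c: "\<And>s1 s2 k. s1 \<le> n \<Longrightarrow> s2 \<le> n \<Longrightarrow> k > d \<Longrightarrow>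
      win_prob n p s1 s2 k + (\<Sum>j = 1..d. c j * win_prob n p s1 s2 (k - j)) = 0"
    using win_prob_common_recurrence[OF assms(2,3), of n] by blast
  \<comment> \<open>Padding with zeros raises the order from \<open>d\<close> to
    \<open>n * (n + 1)\<close>.\<close>
  define c' where "c' = (\<lambda>j. if j \<le> d then c j else 0)"
  have fin: "C_finite_with ?L c' (win_prob n p s1 s2)" if "s1 \<le> n" "s2 \<le> n" for s1 s2
  proof -
    have "(\<Sum>j = 1..?L. c' j * win_prob n p s1 s2 (k - j)) =
        (\<Sum>j = 1..d. c j * win_prob n p s1 s2 (k - j))" for k
      by (rule sum.mono_neutral_cong_right) (use d in \<open>auto simp: c'_def\<close>)
    then show ?thesis
      unfolding C_finite_with_def
      using c[OF that] by (auto simp: eventually_sequentially intro!: exI[of _ "Suc d"])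
  qed
  define D where "D = 1 + (\<Sum>j = 1..?L. monom (c' j) j)"
  have "degree D \<le> ?L"
    unfolding D_def
    by (intro degree_add_le degree_sum_le) (auto intro: order_trans[OF degree_monom_le])
  moreover have "coeff D 0 = 1"
    by (simp add: D_def coeff_sum)
  moreover have "\<exists>N. win_gf n p s1 s2 = fps_of_poly N / fps_of_poly D"
    if "s1 \<le> n" "s2 \<le> n" for s1 s2
    using C_finite_with_rational[OF fin[OF that]] by (simp add: win_gf_def D_def)
  ultimately show ?thesis
    using fin by (intro conjI exI[of _ D] exI[of _ c']) auto
qed

end
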